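(* Let $\hat{\mathbf x}_1,\hat{\mathbf x}_2,\hat{\mathbf x}_3,\hat{\mathbf x}_4$ be four finite points of $\mathrm P\mathbb R^2$ and $\mathbf l$ a line of $\mathrm P\mathbb R^2$ such that the four points and the line are in general position. Let $\boldsymbol\xi_1,\boldsymbol\xi_2,\boldsymbol\xi_3$ be the vertices of the diagonal triangle of the quadrangle $\hat{\mathbf x}_1\hat{\mathbf x}_2\hat{\mathbf x}_3\hat{\mathbf x}_4$. Then the problem of determining a non-degenerate conic $\mathbf C$ in $\mathrm P\mathbb C^2$ such that $\hat{\mathbf x}_i^T\mathbf C\hat{\mathbf x}_i=0$ for $i=1,2,3,4$ and $\mathbf l^T\mathbf C^{-1}\mathbf l=0$ has at most two solutions (up to scale), and they are given by $$\mathbf C_i=[\boldsymbol\xi_{123}]^{-T}\,\mathrm{Diag}(-s_i,\,s_i-1,\,1)\,[\boldsymbol\xi_{123}]^{-1},\quad i=1,2,$$ where $s_i\neq 0,1$ is a root (in $\mathbb C$) of the equation $$(\boldsymbol\xi_3^T\mathbf l)^2s^2-\bigl((\boldsymbol\xi_1^T\mathbf l)^2-(\boldsymbol\xi_2^T\mathbf l)^2+(\boldsymbol\xi_3^T\mathbf l)^2\bigr)s+(\boldsymbol\xi_1^T\mathbf l)^2=0.$$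
   Context: $\mathrm P\mathbb R^2$ and $\mathrm P\mathbb C^2$ are the real and complex projective planes. A hat denotes a finite point in normalized homogeneous coordinates, i.e. a vector of $\mathbb R^3$ whose third component is $1$. A line is given by a nonzero vector $\mathbf l\in\mathbb R^3$ (up to scale), and $\mathbf x$ lies on $\mathbf l$ iff $\mathbf x^T\mathbf l=0$. The vertices of the diagonal triangle are always taken to be the vectors $\boldsymbol\xi_1=(\hat{\mathbf x}_1\times\hat{\mathbf x}_2)\times(\hat{\mathbf x}_3\times\hat{\mathbf x}_4)$, $\boldsymbol\xi_2=(\hat{\mathbf x}_1\times\hat{\mathbf x}_3)\times(\hat{\mathbf x}_2\times\hat{\mathbf x}_4)$, $\boldsymbol\xi_3=(\hat{\mathbf x}_1\times\hat{\mathbf x}_4)\times(\hat{\mathbf x}_2\times\hat{\mathbf x}_3)$, where $\times$ is the cross product. $[\boldsymbol\xi_{123}]$ is the $3\times3$ matrix with columns $\boldsymbol\xi_1,\boldsymbol\xi_2,\boldsymbol\xi_3$, and $[\cdot]^{-T}$ is the inverse transpose. Four points and one line are in general position if no three of the points are collinear, $\mathbf l$ is not a side or diagonal line of the quadrangle (i.e. not one of the six lines joining two of the four points), and $\mathbf l$ is not a side of the diagonal triangle (i.e. not one of the three lines joining two of $\boldsymbol\xi_1,\boldsymbol\xi_2,\boldsymbol\xi_3$). A conic is a nonzero complex symmetric $3\times3$ matrix up to nonzero scale; it is non-degenerate if its determinant is nonzero. The condition $\mathbf l^T\mathbf C^{-1}\mathbf l=0$ says $\mathbf l$ is tangent to $\mathbf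 C$. *)

theory Defs
  imports "HOL-Analysis.Analysis"
begin

unbundle cross3_syntax

type_synonym cmat3 = "complex^3^3"


definition on_line :: "real^3 \<Rightarrow> real^3 \<Rightarrow> bool" where
  "on_line x l \<longleftrightarrow> x \<bullet> l = 0"

definition same_line :: "real^3 \<Rightarrow> real^3 \<Rightarrow> bool" where
  "same_line l m \<longleftrightarrow> (\<exists>k. k \<noteq> 0 \<and> l = k *\<^sub>R m)"

definition collinear_points :: "real^3 \<Rightarrow> real^3 \<Rightarrow> real^3 \<Rightarrow> bool" where
  "collinear_points x y z \<longleftrightarrow> (\<exists>m. m \<noteq> 0 \<and> on_line x m \<and> on_line y m \<and> on_line z m)"

definition finite_point :: "real^3 \<Rightarrow> bool" where
  "finite_point x \<longleftrightarrow> x $ 3 = 1"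


text \<open>A quadrangle is given by the values of \<open>x\<close> at the indices \<open>1, 2, 3, 4\<close>; its other values
  are never used.\<close>

definition diag_vertex1 :: "(nat \<Rightarrow> real^3) \<Rightarrow> real^3" where
  "diag_vertex1 x = (x 1 \<times> x 2) \<times> (x 3 \<times> x 4)"

definition diag_vertex2 :: "(nat \<Rightarrow> real^3) \<Rightarrow> real^3" where
  "diag_vertex2 x = (x 1 \<times> x 3) \<times> (x 2 \<times> x 4)"

definition diag_vertex3 :: "(nat \<Rightarrow> real^3) \<Rightarrow> real^3" where
  "diag_vertex3 x = (x 1 \<times> x 4) \<times> (x 2 \<times> x 3)"

definition general_position :: "(nat \<Rightarrow> real^3) \<Rightarrow> real^3 \<Rightarrow> bool" where
  "general_position x l \<longleftrightarrow>
     (\<forall>i\<in>{1..4}. \<forall>j\<in>{1..4}. \<forall>k\<in>{1..4}.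
        i < j \<and> j < k \<longrightarrow> \<not> collinear_points (x i) (x j) (x k)) \<and>
     (\<forall>i\<in>{1..4}. \<forall>j\<in>{1..4}. i < j \<longrightarrow> \<not> same_line l (x i \<times> x j)) \<and>
     \<not> same_line l (diag_vertex1 x \<times> diag_vertex2 x) \<and>
     \<not> same_line l (diag_vertex1 x \<times> diag_vertex3 x) \<and>
     \<not> same_line l (diag_vertex2 x \<times> diag_vertex3 x)"


text \<open>The inner product of the library on \<open>complex^3\<close> is real-valued, so the bilinear form
  \<open>v\<^sup>T A v\<close> (without conjugation) is written with \<^const>\<open>scalar_product\<close>.\<close>

definition quad_form :: "cmat3 \<Rightarrow> complex^3 \<Rightarrow> complex" where
  "quad_form A v = scalar_product v (A *v v)"

definition cvec :: "real^3 \<Rightarrow> complex^3" where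
  "cvec v = (\<chi> i. complex_of_real (v $ i))"

definition conic :: "cmat3 \<Rightarrow> bool" where
  "conic C \<longleftrightarrow> C \<noteq> 0 \<and> transpose C = C"

definition nondegenerate :: "cmat3 \<Rightarrow> bool" where
  "nondegenerate C \<longleftrightarrow> det C \<noteq> 0"

definition scale_rel :: "(cmat3 \<times> cmat3) set" where
  "scale_rel = {(C, D). \<exists>k. k \<noteq> 0 \<and> D = (\<chi> i j. k * C $ i $ j)}"

text \<open>The conic represented by a matrix, as the set of all its nonzero multiples.\<close>

definition conic_class :: "cmat3 \<Rightarrow> cmat3 set" where
  "conic_class C = scale_rel `` {C}"

lemma equiv_scale_rel: "equiv UNIV scale_rel"
proof (rule equivI)
  show "refl scale_rel"
    by (auto simp: refl_on_def scale_rel_def vec_eq_iff intro: exI[of _ 1])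
  show "sym scale_rel"
  proof (rule symI)
    fix C D assume "(C, D) \<in> scale_rel"
    then obtain k where "k \<noteq> 0" "D = (\<chi> i j. k * C $ i $ j)"
      by (auto simp: scale_rel_def)
    then have "inverse k \<noteq> 0 \<and> C = (\<chi> i j. inverse k * D $ i $ j)"
      by (simp add: vec_eq_iff)
    then show "(D, C) \<in> scale_rel"
      unfolding scale_rel_def by blast
  qed
  show "trans scale_rel"
  proof (rule transI)
    fix C D E assume "(C, D) \<in> scale_rel" "(D, E) \<in> scale_rel"
    then obtain k m where "k \<noteq> 0" "D = (\<chi> i j. k * C $ i $ j)"
      "m \<noteq> 0" "E = (\<chi> i j. m * D $ i $ j)"
      by (auto simp: scale_rel_def)
    then have "m * k \<noteq> 0 \<and> E = (\<chi> i j. (m * k) * C $ i $ j)"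
      by (simp add: vec_eq_iff)
    then show "(C, E) \<in> scale_rel"
      unfolding scale_rel_def by blast
  qed
qed simp

definition solution_matrices :: "(nat \<Rightarrow> real^3) \<Rightarrow> real^3 \<Rightarrow> cmat3 set" where
  "solution_matrices x l =
     {C. conic C \<and> nondegenerate C \<and>
         (\<forall>i\<in>{1..4}. quad_form C (cvec (x i)) = 0) \<and>
         quad_form (matrix_inv C) (cvec l) = 0}"

definition solution_conics :: "(nat \<Rightarrow> real^3) \<Rightarrow> real^3 \<Rightarrow> cmat3 set set" where
  "solution_conics x l = conic_class ` solution_matrices x l"


definition xi_matrix :: "(nat \<Rightarrow> real^3) \<Rightarrow> cmat3" where
  "xi_matrix x =
     transpose (vector [cvec (diag_vertex1 x), cvec (diag_vertex2 x), cvec (diag_vertex3 x)])"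

definition Diag :: "complex \<Rightarrow> complex \<Rightarrow> complex \<Rightarrow> cmat3" where
  "Diag a b c = (\<chi> i j. if i = j then vector [a, b, c] $ i else 0)"

definition conic_matrix :: "(nat \<Rightarrow> real^3) \<Rightarrow> complex \<Rightarrow> cmat3" where
  "conic_matrix x s =
     transpose (matrix_inv (xi_matrix x)) ** Diag (- s) (s - 1) 1 ** matrix_inv (xi_matrix x)"

definition tangency_root :: "(nat \<Rightarrow> real^3) \<Rightarrow> real^3 \<Rightarrow> complex \<Rightarrow> bool" where
  "tangency_root x l s \<longleftrightarrow>
     complex_of_real ((diag_vertex3 x \<bullet> l)^2) * s^2
     - complex_of_real ((diag_vertex1 x \<bullet> l)^2 - (diag_vertex2 x \<bullet> l)^2 + (diag_vertex3 x \<bullet> l)^2) * s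
     + complex_of_real ((diag_vertex1 x \<bullet> l)^2) = 0"

end

theory Submission
  imports Defs
begin

text \<open>
  The theorem is linear algebra in the frame of the diagonal triangle. Let \<open>X\<close> have the
  columns \<open>\<xi>\<^sub>1, \<xi>\<^sub>2, \<xi>\<^sub>3\<close>. Cramer's rule, which writes \<open>x\<^sub>4\<close> as a combination of \<open>x\<^sub>1, x\<^sub>2, x\<^sub>3\<close>, shows that
  the four points are, up to nonzero factors, the images under \<open>X\<close> of the sign vectors
  \<open>(-1, 1, -1)\<close>, \<open>(-1, -1, 1)\<close>, \<open>(1, 1, 1)\<close> and \<open>(-1, 1, 1)\<close> (\<open>points_in_diagonal_frame\<close>). The factors
  and \<open>det X\<close> are, up to signs and powers of \<open>2\<close>, products of determinants of three of the points, so they are nonzero because no three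
  points are collinear.

  Put \<open>C = X\<^sup>-\<^sup>T E X\<^sup>-\<^sup>1\<close>. The conic \<open>C\<close> passes through the four points iff the quadratic form of \<open>E\<close>
  vanishes on the four sign vectors, and for a symmetric \<open>E\<close> these four equations say that \<open>E\<close> is
  diagonal with trace zero (\<open>symmetric_through_sign_points_iff\<close>). Thus the pencil through the four points
  consists of the conics with \<open>E = Diag(a, b, c)\<close>, \<open>a + b + c = 0\<close>. Such a conic is non-degenerate iff
  \<open>a, b, c\<close> are nonzero, and its dual conic has the matrix \<open>X Diag(1/a, 1/b, 1/c) X\<^sup>T\<close>; hence, writing
  \<open>X\<^sup>T l = (p, q, r)\<close>, tangency to \<open>l\<close> reads \<open>p\<^sup>2/a + q\<^sup>2/b + r\<^sup>2/c = 0\<close>.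

  Dividing by \<open>c\<close> normalises the diagonal to \<open>(-s, s - 1, 1)\<close> with \<open>s = -a/c\<close>. Non-degeneracy becomes
  \<open>s \<noteq> 0, 1\<close>, and clearing denominators turns tangency into the quadratic equation for \<open>s\<close>. Its
  coefficients do not all vanish: otherwise \<open>p = q = r = 0\<close>, and then \<open>l = 0\<close> because \<open>X\<close> is
  invertible. So there are at most two values of \<open>s\<close>.
\<close>

section \<open>Quadratic forms and congruence\<close>

lemma scalar_product_transpose:
  fixes P :: cmat3
  shows "scalar_product v (transpose P *v w) = scalar_product (P *v v) w"
  unfolding matrix_vector_mult_def transpose_def
  by (simp add: scalar_product_def sum_3 algebra_simps)

lemma quad_form_congruence: "quad_form (transpose P ** A ** P) v = quad_form A (P *v v)"
proof -
  have "(transpose P ** A ** P) *v v = transpose P *v (A *v (P *v v))"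
    by (simp only: matrix_vector_mul_assoc matrix_mul_assoc)
  then show ?thesis by (simp only: quad_form_def scalar_product_transpose)
qed

lemma quad_form_scale: "quad_form A (k *s v) = k^2 * quad_form A v"
  by (simp add: quad_form_def scalar_product_def matrix_vector_mult_def sum_3
      algebra_simps power2_eq_square)

lemma quad_form_Diag:
  "quad_form (Diag a b c) v = a * (v$1)^2 + b * (v$2)^2 + c * (v$3)^2"
  by (simp add: quad_form_def scalar_product_def matrix_vector_mult_def Diag_def sum_3
      algebra_simps power2_eq_square)

lemma det_Diag: "det (Diag a b c) = a * b * c"
  by (simp add: det_3 Diag_def)

lemma Diag_mult: "Diag a b c ** Diag a' b' c' = Diag (a * a') (b * b') (c * c')"
  by (simp add: vec_eq_iff forall_3 Diag_def matrix_matrix_mult_def sum_3)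

lemma scale_eq_Diag_mult: "(\<chi> i j. k * C $ i $ j) = Diag k k k ** C"
  by (simp add: vec_eq_iff forall_3 Diag_def matrix_matrix_mult_def sum_3)

lemma Diag_scalar_commute: "Diag k k k ** C = C ** Diag k k k"
  by (simp add: vec_eq_iff forall_3 Diag_def matrix_matrix_mult_def sum_3)

lemma Diag_one: "Diag 1 1 1 = mat 1"
  by (simp add: vec_eq_iff forall_3 Diag_def mat_def)

lemma transpose_Diag: "transpose (Diag a b c) = Diag a b c"
  by (simp add: vec_eq_iff forall_3 Diag_def transpose_def)

lemma matrix_inv_mult:
  fixes A :: "'a::field^'n^'n"
  assumes "invertible A"
  shows "A ** matrix_inv A = mat 1" "matrix_inv A ** A = mat 1"
  using someI_ex[OF assms[unfolded invertible_def]] by (simp_all add: matrix_inv_def)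

lemma matrix_inv_unique:
  fixes A B :: "'a::field^'n^'n"
  assumes "A ** B = mat 1"
  shows "matrix_inv A = B"
proof -
  have "invertible A"
    using assms matrix_left_right_inverse[of A B] by (auto simp: invertible_def)
  then have "matrix_inv A ** (A ** B) = B"
    by (simp add: matrix_mul_assoc matrix_inv_mult)
  with assms show ?thesis by simp
qed

text \<open>The squares of the coordinates are \<open>1\<close> at every sign vector, so the diagonal of \<open>E\<close> contributes only
  its trace to each of the four equations. The equations therefore are a \<open>4 \<times> 4\<close> system in the trace and
  the three off-diagonal entries; its matrix is of Hadamard type, hence invertible.\<close>

lemma symmetric_through_sign_points_iff:
  "transpose E = E \<and> quad_form E (vector [1, 1, 1]) = 0 \<and> quad_form E (vector [-1, 1, -1]) = 0
     \<and> quad_form E (vector [-1, -1, 1]) = 0 \<and> quad_form E (vector [-1, 1, 1]) = 0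
   \<longleftrightarrow> (\<exists>a b c. a + b + c = 0 \<and> E = Diag a b c)" (is "?L \<longleftrightarrow> ?R")
proof
  assume L: ?L
  then have "transpose E $ i $ j = E $ i $ j" for i j by simp
  then have sym: "E$2$1 = E$1$2" "E$3$1 = E$1$3" "E$3$2 = E$2$3"
    by (simp_all only: transpose_def vec_lambda_beta)
  have expand: "quad_form E (vector [a, b, c]) = E$1$1 * a^2 + E$2$2 * b^2 + E$3$3 * c^2
      + 2 * E$1$2 * a * b + 2 * E$1$3 * a * c + 2 * E$2$3 * b * c" for a b c
    by (simp add: quad_form_def scalar_product_def matrix_vector_mult_def sum_3 sym
        algebra_simps power2_eq_square)
  \<comment> \<open>The functions \<open>1, v\<^sub>1v\<^sub>2, v\<^sub>1v\<^sub>3, v\<^sub>2v\<^sub>3\<close> of the sign vector \<open>v\<close> are pairwise orthogonal on the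
    four vectors; weighting the four equations with one of the last three isolates one off-diagonal entry.\<close>
  have "8 * E$1$2 = quad_form E (vector [1, 1, 1]) - quad_form E (vector [-1, 1, -1])
      + quad_form E (vector [-1, -1, 1]) - quad_form E (vector [-1, 1, 1])"
    "8 * E$1$3 = quad_form E (vector [1, 1, 1]) + quad_form E (vector [-1, 1, -1])
      - quad_form E (vector [-1, -1, 1]) - quad_form E (vector [-1, 1, 1])"
    "8 * E$2$3 = quad_form E (vector [1, 1, 1]) - quad_form E (vector [-1, 1, -1])
      - quad_form E (vector [-1, -1, 1]) + quad_form E (vector [-1, 1, 1])"
    unfolding expand by simp_all
  then have off_diagonal: "E$1$2 = 0" "E$1$3 = 0" "E$2$3 = 0"
    using L by simp_all
  then have trace: "E$1$1 + E$2$2 + E$3$3 = 0"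
    using L expand[of 1 1 1] by simp
  from sym off_diagonal have "E = Diag (E$1$1) (E$2$2) (E$3$3)"
    by (simp add: vec_eq_iff forall_3 Diag_def)
  with trace show ?R by blast
qed (auto simp: quad_form_Diag transpose_Diag)

section \<open>The diagonal triangle\<close>

text \<open>The determinant of three points, written as a triple product so that identities between
  cross products apply to it directly.\<close>

abbreviation bracket :: "real^3 \<Rightarrow> real^3 \<Rightarrow> real^3 \<Rightarrow> real" where
  "bracket p q r \<equiv> p \<bullet> (q \<times> r)"

lemma bracket_nonzero:
  assumes "\<not> collinear_points p q r"
  shows "bracket p q r \<noteq> 0"
proof
  assume "bracket p q r = 0"
  then have "\<not> invertible (vector [p, q, r] :: real^3^3)"
    by (simp add: dot_cross_det invertible_det_nz)
  then obtain m where "m \<noteq> 0" "(vector [p, q, r] :: real^3^3) *v m = 0"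
    by (auto simp: invertible_left_inverse matrix_left_invertible_ker)
  then have "collinear_points p q r"
    by (auto simp: collinear_points_def on_line_def matrix_vector_mult_def vec_eq_iff forall_3
        inner_vec_def sum_3)
  with assms show False by contradiction
qed

text \<open>Each vertex of the diagonal triangle is the intersection of two opposite sides. Of these two, the
  side that does not contain \<open>x\<^sub>4\<close> is used to expand the vertex, so that all three vertices are written in
  the basis \<open>x\<^sub>1, x\<^sub>2, x\<^sub>3\<close>. The coefficients are the numerators that
  Cramer's rule gives for the coordinates of \<open>x\<^sub>4\<close>.\<close>

lemma diag_vertex_expansion:
  "diag_vertex1 x = - (bracket (x 4) (x 2) (x 3) *\<^sub>R x 1 + bracket (x 1) (x 4) (x 3) *\<^sub>R x 2)"
  "diag_vertex2 x = bracket (x 4) (x 2) (x 3) *\<^sub>R x 1 + bracket (x 1) (x 2) (x 4) *\<^sub>R x 3"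
  "diag_vertex3 x = bracket (x 1) (x 4) (x 3) *\<^sub>R x 2 + bracket (x 1) (x 2) (x 4) *\<^sub>R x 3"
  by (simp_all add: diag_vertex1_def diag_vertex2_def diag_vertex3_def vec_eq_iff forall_3
      cross3_simps)

lemma cramer_four_points:
  "bracket p q r *\<^sub>R s = bracket s q r *\<^sub>R p + bracket p s r *\<^sub>R q + bracket p q s *\<^sub>R r"
  by (simp add: vec_eq_iff forall_3 cross3_simps)

text \<open>Let \<open>\<alpha>, \<beta>, \<gamma>\<close> be the numerators in Cramer's rule for \<open>x\<^sub>4\<close>. The vertices are the sums of two of the vectors
  \<open>\<alpha>x\<^sub>1, \<beta>x\<^sub>2, \<gamma>x\<^sub>3\<close>, the first one with a minus sign, so signed sums of the vertices recover each of
  these vectors and their total, which is a multiple of \<open>x\<^sub>4\<close>. These signs are the coordinates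
  of the four points in the frame of the diagonal triangle.\<close>

lemma points_in_diagonal_frame:
  "diag_vertex2 x - diag_vertex1 x - diag_vertex3 x = (2 * bracket (x 4) (x 2) (x 3)) *\<^sub>R x 1"
  "- diag_vertex1 x - diag_vertex2 x + diag_vertex3 x = (2 * bracket (x 1) (x 4) (x 3)) *\<^sub>R x 2"
  "diag_vertex1 x + diag_vertex2 x + diag_vertex3 x = (2 * bracket (x 1) (x 2) (x 4)) *\<^sub>R x 3"
  "diag_vertex2 x - diag_vertex1 x + diag_vertex3 x = (2 * bracket (x 1) (x 2) (x 3)) *\<^sub>R x 4"
  using cramer_four_points[of "x 1" "x 2" "x 3" "x 4"]
  by (simp_all add: diag_vertex_expansion vec_eq_iff forall_3 algebra_simps)

text \<open>Replacing three vectors by their pairwise sums multiplies the determinant by \<open>-2\<close>; the minus sign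
  in the expansion of the first vertex turns this into \<open>2\<close>.\<close>

lemma det_xi_matrix:
  "det (xi_matrix x) = complex_of_real (2 * bracket (x 4) (x 2) (x 3) * bracket (x 1) (x 4) (x 3)
     * bracket (x 1) (x 2) (x 4) * bracket (x 1) (x 2) (x 3))"
proof -
  have "bracket (- (a *\<^sub>R p + b *\<^sub>R q)) (a *\<^sub>R p + c *\<^sub>R r) (b *\<^sub>R q + c *\<^sub>R r)
      = 2 * a * b * c * bracket p q r" for a b c p q r
    by (simp add: cross3_simps)
  moreover have "det (xi_matrix x)
      = complex_of_real (bracket (diag_vertex1 x) (diag_vertex2 x) (diag_vertex3 x))"
    by (simp add: dot_cross_det xi_matrix_def transpose_def det_3 cvec_def)
  ultimately show ?thesis by (simp add: diag_vertex_expansion)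
qed

lemma cvec_scale: "cvec (k *\<^sub>R v) = complex_of_real k *s cvec v"
  by (simp add: cvec_def vec_eq_iff)

lemma xi_matrix_mult:
  "xi_matrix x *v vector [complex_of_real a, complex_of_real b, complex_of_real c]
   = cvec (a *\<^sub>R diag_vertex1 x + b *\<^sub>R diag_vertex2 x + c *\<^sub>R diag_vertex3 x)"
  unfolding matrix_vector_mult_def
  by (simp add: xi_matrix_def transpose_def cvec_def vec_eq_iff sum_3 algebra_simps)

lemma transpose_xi_matrix_mult:
  "transpose (xi_matrix x) *v cvec l = vector [complex_of_real (diag_vertex1 x \<bullet> l),
     complex_of_real (diag_vertex2 x \<bullet> l), complex_of_real (diag_vertex3 x \<bullet> l)]"
  unfolding matrix_vector_mult_def
  by (simp add: xi_matrix_def transpose_def cvec_def vec_eq_iff forall_3 sum_3 inner_vec_def)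

section \<open>The pencil of conics through the four points\<close>

text \<open>Up to sign these are the determinants of the four triples of points. The order of the arguments is
  that of Cramer's rule for \<open>x\<^sub>4\<close>.\<close>

locale quadrangle =
  fixes x :: "nat \<Rightarrow> real^3"
  assumes brackets: "bracket (x 4) (x 2) (x 3) \<noteq> 0" "bracket (x 1) (x 4) (x 3) \<noteq> 0"
    "bracket (x 1) (x 2) (x 4) \<noteq> 0" "bracket (x 1) (x 2) (x 3) \<noteq> 0"
begin

text \<open>The symmetric forms for which the vertices of the diagonal triangle are pairwise conjugate; when
  non-degenerate, the conics that have it as a self-polar triangle. The pencil through the four points is the part with \<open>a + b + c = 0\<close>.\<close>

definition self_polar :: "complex \<Rightarrow> complex \<Rightarrow> complex \<Rightarrow> cmat3" where
  "self_polar a b c = transpose (matrix_inv (xi_matrix x)) ** Diag a b c ** matrix_inv (xi_matrix x)"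

lemma invertible_xi_matrix: "invertible (xi_matrix x)"
  using brackets by (simp add: invertible_det_nz det_xi_matrix)

lemmas xi_inverse = matrix_inv_mult[OF invertible_xi_matrix]

lemma xi_inverse_transpose:
  "transpose (xi_matrix x) ** transpose (matrix_inv (xi_matrix x)) = mat 1"
  "transpose (matrix_inv (xi_matrix x)) ** transpose (xi_matrix x) = mat 1"
  by (simp_all add: xi_inverse transpose_mat flip: matrix_transpose_mul)

lemma congruence_eq_iff:
  "C = transpose (matrix_inv (xi_matrix x)) ** E ** matrix_inv (xi_matrix x)
   \<longleftrightarrow> transpose (xi_matrix x) ** C ** xi_matrix x = E"
  (is "C = transpose ?Q ** E ** ?Q \<longleftrightarrow> transpose ?X ** C ** ?X = E")
proof
  assume "C = transpose ?Q ** E ** ?Q"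
  then have "transpose ?X ** C ** ?X = (transpose ?X ** transpose ?Q) ** E ** (?Q ** ?X)"
    by (simp only: matrix_mul_assoc)
  then show "transpose ?X ** C ** ?X = E"
    by (simp add: xi_inverse xi_inverse_transpose)
next
  assume "transpose ?X ** C ** ?X = E"
  then have "transpose ?Q ** E ** ?Q = (transpose ?Q ** transpose ?X) ** C ** (?X ** ?Q)"
    by (auto simp only: matrix_mul_assoc)
  then show "C = transpose ?Q ** E ** ?Q"
    by (simp add: xi_inverse xi_inverse_transpose)
qed

lemma symmetric_congruence_iff:
  "transpose (transpose (xi_matrix x) ** C ** xi_matrix x) = transpose (xi_matrix x) ** C ** xi_matrix x
   \<longleftrightarrow> transpose C = C"
proof -
  have "transpose (transpose (xi_matrix x) ** C ** xi_matrix x)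
      = transpose (xi_matrix x) ** transpose C ** xi_matrix x"
    by (simp add: matrix_transpose_mul matrix_mul_assoc)
  then show ?thesis
    by (metis congruence_eq_iff)
qed

text \<open>A nonzero factor on a vector does not affect whether a quadratic form vanishes there, so each point
  may be replaced by its multiple with sign coordinates.\<close>

lemma on_conic_iff:
  "quad_form C (cvec (x 1)) = 0 \<longleftrightarrow> quad_form C (xi_matrix x *v vector [-1, 1, -1]) = 0"
  "quad_form C (cvec (x 2)) = 0 \<longleftrightarrow> quad_form C (xi_matrix x *v vector [-1, -1, 1]) = 0"
  "quad_form C (cvec (x 3)) = 0 \<longleftrightarrow> quad_form C (xi_matrix x *v vector [1, 1, 1]) = 0"
  "quad_form C (cvec (x 4)) = 0 \<longleftrightarrow> quad_form C (xi_matrix x *v vector [-1, 1, 1]) = 0"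
  using xi_matrix_mult[of x "-1" 1 "-1"] xi_matrix_mult[of x "-1" "-1" 1]
    xi_matrix_mult[of x 1 1 1] xi_matrix_mult[of x "-1" 1 1] brackets
  by (auto simp: points_in_diagonal_frame quad_form_scale cvec_scale)

lemma symmetric_through_points_iff:
  "transpose C = C \<and> (\<forall>i\<in>{1..4}. quad_form C (cvec (x i)) = 0)
   \<longleftrightarrow> (\<exists>a b c. a + b + c = 0 \<and> C = self_polar a b c)"
proof -
  have "{1..4::nat} = {1, 2, 3, 4}" by auto
  then show ?thesis
    using symmetric_through_sign_points_iff[of "transpose (xi_matrix x) ** C ** xi_matrix x"]
    by (auto simp: symmetric_congruence_iff on_conic_iff quad_form_congruence self_polar_def
        congruence_eq_iff simp del: One_nat_def)
qed

lemma nondegenerate_self_polar: "nondegenerate (self_polar a b c) \<longleftrightarrow> a \<noteq> 0 \<and> b \<noteq> 0 \<and> c \<noteq> 0"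
proof -
  have "det (matrix_inv (xi_matrix x)) \<noteq> 0"
    using xi_inverse by (metis invertible_def invertible_det_nz)
  then show ?thesis
    by (simp add: nondegenerate_def self_polar_def det_mul det_transpose det_Diag)
qed

section \<open>Tangency to the line\<close>

text \<open>The dual of \<open>X\<^sup>-\<^sup>T D X\<^sup>-\<^sup>1\<close> is \<open>X D\<^sup>-\<^sup>1 X\<^sup>T\<close>, so the dual form at \<open>l\<close> is the form of \<open>D\<^sup>-\<^sup>1\<close> at
  \<open>X\<^sup>T l\<close>, whose coordinates are the inner products of \<open>l\<close> with the vertices.\<close>

lemma tangent_self_polar:
  assumes "a \<noteq> 0" "b \<noteq> 0" "c \<noteq> 0"
  shows "quad_form (matrix_inv (self_polar a b c)) (cvec l)
    = complex_of_real (diag_vertex1 x \<bullet> l)^2 / a + complex_of_real (diag_vertex2 x \<bullet> l)^2 / b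
      + complex_of_real (diag_vertex3 x \<bullet> l)^2 / c"
proof -
  let ?X = "xi_matrix x" and ?Q = "matrix_inv (xi_matrix x)" and ?D = "Diag (1/a) (1/b) (1/c)"
  have "self_polar a b c ** (?X ** ?D ** transpose ?X)
      = transpose ?Q ** Diag a b c ** (?Q ** ?X) ** ?D ** transpose ?X"
    by (simp only: self_polar_def matrix_mul_assoc)
  also have "\<dots> = transpose ?Q ** (Diag a b c ** ?D) ** transpose ?X"
    by (simp add: xi_inverse matrix_mul_assoc)
  also have "\<dots> = mat 1"
    using assms by (simp add: Diag_mult Diag_one xi_inverse_transpose)
  finally have "matrix_inv (self_polar a b c)
      = transpose (transpose ?X) ** ?D ** transpose ?X"
    by (simp add: matrix_inv_unique)
  then show ?thesis
    by (simp only: quad_form_congruence transpose_xi_matrix_mult quad_form_Diag) simp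
qed

lemma scale_self_polar:
  "(\<chi> i j. k * self_polar a b c $ i $ j) = self_polar (k * a) (k * b) (k * c)"
proof -
  let ?Q = "matrix_inv (xi_matrix x)"
  have "(\<chi> i j. k * self_polar a b c $ i $ j) = (Diag k k k ** transpose ?Q) ** Diag a b c ** ?Q"
    by (simp only: scale_eq_Diag_mult self_polar_def matrix_mul_assoc)
  also have "\<dots> = transpose ?Q ** (Diag k k k ** Diag a b c) ** ?Q"
    by (simp only: Diag_scalar_commute[of k "transpose ?Q"] matrix_mul_assoc)
  finally show ?thesis by (simp only: Diag_mult self_polar_def)
qed

lemma conic_class_self_polar:
  "k \<noteq> 0 \<Longrightarrow> conic_class (self_polar (k * a) (k * b) (k * c)) = conic_class (self_polar a b c)"
  unfolding conic_class_def
  by (rule sym, rule equiv_class_eq[OF equiv_scale_rel]) (auto simp: scale_rel_def scale_self_polar)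

lemma conic_matrix_eq_self_polar: "conic_matrix x s = self_polar (- s) (s - 1) 1"
  by (simp add: conic_matrix_def self_polar_def)

text \<open>The quadratic in \<open>s\<close> is the tangency condition multiplied by \<open>s (s - 1)\<close>.\<close>

lemma tangency_root_iff:
  assumes "s \<noteq> 0" "s \<noteq> 1"
  shows "quad_form (matrix_inv (conic_matrix x s)) (cvec l) = 0 \<longleftrightarrow> tangency_root x l s"
proof -
  have "complex_of_real (diag_vertex1 x \<bullet> l)^2 / (- s) + complex_of_real (diag_vertex2 x \<bullet> l)^2 / (s - 1)
      + complex_of_real (diag_vertex3 x \<bullet> l)^2 / 1
     = (complex_of_real ((diag_vertex3 x \<bullet> l)^2) * s^2
     - complex_of_real ((diag_vertex1 x \<bullet> l)^2 - (diag_vertex2 x \<bullet> l)^2 + (diag_vertex3 x \<bullet> l)^2) * s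
     + complex_of_real ((diag_vertex1 x \<bullet> l)^2)) / (s * (s - 1))"
    using assms by (simp add: divide_simps power2_eq_square) (simp add: algebra_simps)
  moreover have "quad_form (matrix_inv (conic_matrix x s)) (cvec l)
    = complex_of_real (diag_vertex1 x \<bullet> l)^2 / (- s) + complex_of_real (diag_vertex2 x \<bullet> l)^2 / (s - 1)
      + complex_of_real (diag_vertex3 x \<bullet> l)^2 / 1"
    unfolding conic_matrix_eq_self_polar
    by (rule tangent_self_polar) (use assms in auto)
  ultimately show ?thesis using assms by (simp add: tangency_root_def)
qed

lemma conic_iff: "nondegenerate C \<Longrightarrow> conic C \<longleftrightarrow> transpose C = C"
  by (auto simp: conic_def nondegenerate_def det_3)

lemma conic_matrix_solution_iff:
  "conic_matrix x s \<in> solution_matrices x l \<longleftrightarrow> s \<noteq> 0 \<and> s \<noteq> 1 \<and> tangency_root x l s"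
proof -
  have "transpose (conic_matrix x s) = conic_matrix x s
      \<and> (\<forall>i\<in>{1..4}. quad_form (conic_matrix x s) (cvec (x i)) = 0)"
    unfolding symmetric_through_points_iff conic_matrix_eq_self_polar
    by (intro exI[of _ "- s"] exI[of _ "s - 1"] exI[of _ 1]) simp
  moreover have "nondegenerate (conic_matrix x s) \<longleftrightarrow> s \<noteq> 0 \<and> s \<noteq> 1"
    by (simp add: conic_matrix_eq_self_polar nondegenerate_self_polar)
  ultimately show ?thesis
    using tangency_root_iff by (auto simp: solution_matrices_def conic_iff)
qed

lemma solution_matrices_iff:
  "C \<in> solution_matrices x l \<longleftrightarrow> (\<exists>a b c. C = self_polar a b c \<and> a \<noteq> 0 \<and> b \<noteq> 0 \<and> c \<noteq> 0
     \<and> a + b + c = 0 \<and> complex_of_real (diag_vertex1 x \<bullet> l)^2 / a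
       + complex_of_real (diag_vertex2 x \<bullet> l)^2 / b + complex_of_real (diag_vertex3 x \<bullet> l)^2 / c = 0)"
proof -
  have "C \<in> solution_matrices x l \<longleftrightarrow> (\<exists>a b c. a + b + c = 0 \<and> C = self_polar a b c)
      \<and> nondegenerate C \<and> quad_form (matrix_inv C) (cvec l) = 0"
    unfolding symmetric_through_points_iff[symmetric]
    by (auto simp: solution_matrices_def conic_iff)
  also have "\<dots> \<longleftrightarrow> (\<exists>a b c. a + b + c = 0 \<and> C = self_polar a b c
      \<and> nondegenerate (self_polar a b c) \<and> quad_form (matrix_inv (self_polar a b c)) (cvec l) = 0)"
    by blast
  also have "\<dots> \<longleftrightarrow> (\<exists>a b c. C = self_polar a b c \<and> a \<noteq> 0 \<and> b \<noteq> 0 \<and> c \<noteq> 0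
     \<and> a + b + c = 0 \<and> complex_of_real (diag_vertex1 x \<bullet> l)^2 / a
       + complex_of_real (diag_vertex2 x \<bullet> l)^2 / b + complex_of_real (diag_vertex3 x \<bullet> l)^2 / c = 0)"
    unfolding nondegenerate_self_polar by (intro ex_cong1) (auto simp: tangent_self_polar)
  finally show ?thesis .
qed

text \<open>On a solution \<open>c \<noteq> 0\<close>, so its class contains the representative with third diagonal entry \<open>1\<close>, and
  the trace condition leaves the single parameter \<open>s = -a/c\<close>. The tangency condition is homogeneous
  in \<open>(a, b, c)\<close> and survives the rescaling.\<close>

lemma solution_conics_eq:
  "solution_conics x l =
    {conic_class (conic_matrix x s) | s. s \<noteq> 0 \<and> s \<noteq> 1 \<and> tangency_root x l s}"
proof -
  have "\<exists>s. conic_class C = conic_class (conic_matrix x s) \<and> conic_matrix x s \<in> solution_matrices x l"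
    if "C \<in> solution_matrices x l" for C
  proof -
    from that obtain a b c where C: "C = self_polar a b c"
      and nz: "a \<noteq> 0" "b \<noteq> 0" "c \<noteq> 0" and sum: "a + b + c = 0"
      and tangent: "complex_of_real (diag_vertex1 x \<bullet> l)^2 / a
       + complex_of_real (diag_vertex2 x \<bullet> l)^2 / b + complex_of_real (diag_vertex3 x \<bullet> l)^2 / c = 0"
      unfolding solution_matrices_iff by blast
    define s where "s = - a / c"
    have "s - 1 = b / c"
      using nz sum by (simp add: s_def field_simps) (metis add_eq_0_iff add.commute)
    then have normalised: "conic_matrix x s = self_polar (a / c) (b / c) (c / c)"
      using nz by (simp add: conic_matrix_eq_self_polar s_def)
    have "C = self_polar (c * (a / c)) (c * (b / c)) (c * (c / c))"
      using nz by (simp add: C)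
    then have "conic_class C = conic_class (conic_matrix x s)"
      using nz by (simp only: normalised conic_class_self_polar[OF nz(3)])
    moreover have "conic_matrix x s \<in> solution_matrices x l"
      unfolding solution_matrices_iff
    proof (intro exI conjI)
      show "conic_matrix x s = self_polar (a / c) (b / c) (c / c)" by (rule normalised)
      show "a / c + b / c + c / c = 0"
        using sum by (simp only: flip: add_divide_distrib) simp
      have "complex_of_real (diag_vertex1 x \<bullet> l)^2 / (a / c)
         + complex_of_real (diag_vertex2 x \<bullet> l)^2 / (b / c)
         + complex_of_real (diag_vertex3 x \<bullet> l)^2 / (c / c)
         = c * (complex_of_real (diag_vertex1 x \<bullet> l)^2 / a
         + complex_of_real (diag_vertex2 x \<bullet> l)^2 / b + complex_of_real (diag_vertex3 x \<bullet> l)^2 / c)"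
        using nz by (simp add: distrib_left mult.commute)
      then show "complex_of_real (diag_vertex1 x \<bullet> l)^2 / (a / c)
         + complex_of_real (diag_vertex2 x \<bullet> l)^2 / (b / c)
         + complex_of_real (diag_vertex3 x \<bullet> l)^2 / (c / c) = 0"
        by (simp only: tangent mult_zero_right)
    qed (use nz in simp_all)
    ultimately show ?thesis by blast
  qed
  then have "solution_conics x l = {conic_class (conic_matrix x s) | s.
      conic_matrix x s \<in> solution_matrices x l}"
    unfolding solution_conics_def by blast
  then show ?thesis by (simp only: conic_matrix_solution_iff)
qed

lemma line_zero_if_through_diag_vertices:
  assumes "diag_vertex1 x \<bullet> l = 0" "diag_vertex2 x \<bullet> l = 0" "diag_vertex3 x \<bullet> l = 0"
  shows "l = 0"
proof -
  have "transpose (xi_matrix x) *v cvec l = 0"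
    unfolding transpose_xi_matrix_mult by (simp add: assms vec_eq_iff forall_3)
  then have "transpose (matrix_inv (xi_matrix x)) *v (transpose (xi_matrix x) *v cvec l) = 0"
    by (simp only: matrix_vector_mult_0_right)
  then have "cvec l = 0"
    by (simp only: matrix_vector_mul_assoc xi_inverse_transpose matrix_vector_mul_lid)
  then show ?thesis by (simp add: cvec_def vec_eq_iff)
qed

text \<open>The equation may have degree below two, so the bound needs that it is not the zero polynomial: if the
  outer coefficients vanish, then the middle one is \<open>(\<xi>\<^sub>2\<^sup>Tl)\<^sup>2\<close>, and not all three products are zero.\<close>

lemma tangency_roots:
  assumes "l \<noteq> 0"
  shows "finite {s. s \<noteq> 0 \<and> s \<noteq> 1 \<and> tangency_root x l s}"
    and "card {s. s \<noteq> 0 \<and> s \<noteq> 1 \<and> tangency_root x l s} \<le> 2"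
proof -
  let ?p = "diag_vertex1 x \<bullet> l" and ?q = "diag_vertex2 x \<bullet> l" and ?r = "diag_vertex3 x \<bullet> l"
  define f where "f = [:complex_of_real (?p^2), - complex_of_real (?p^2 - ?q^2 + ?r^2),
    complex_of_real (?r^2):]"
  have roots: "{s. s \<noteq> 0 \<and> s \<noteq> 1 \<and> tangency_root x l s} \<subseteq> {s. poly f s = 0}"
    by (auto simp: tangency_root_def f_def algebra_simps power2_eq_square)
  have "f \<noteq> 0"
    using line_zero_if_through_diag_vertices assms
    by (auto simp: f_def simp del: of_real_add of_real_diff of_real_power)
  then have fin: "finite {s. poly f s = 0}" and "card {s. poly f s = 0} \<le> degree f"
    by (simp_all add: poly_roots_finite card_poly_roots_bound)
  moreover have "degree f \<le> 2" by (simp add: f_def)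
  ultimately show "finite {s. s \<noteq> 0 \<and> s \<noteq> 1 \<and> tangency_root x l s}"
    and "card {s. s \<noteq> 0 \<and> s \<noteq> 1 \<and> tangency_root x l s} \<le> 2"
    using roots card_mono[OF fin roots] by (auto intro: finite_subset)
qed

end

theorem theorem3:
  fixes x :: "nat \<Rightarrow> real^3" and l :: "real^3"
  assumes "\<And>i. i \<in> {1..4} \<Longrightarrow> finite_point (x i)"
    and "l \<noteq> 0"
    and "general_position x l"
  shows "invertible (xi_matrix x)
    \<and> finite (solution_conics x l) \<and> card (solution_conics x l) \<le> 2
    \<and> solution_conics x l =
        {conic_class (conic_matrix x s) | s. s \<noteq> 0 \<and> s \<noteq> 1 \<and> tangency_root x l s}"
proof -
  have nc: "bracket (x i) (x j) (x k) \<noteq> 0"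
    if "i < j" "j < k" "i \<in> {1..4}" "j \<in> {1..4}" "k \<in> {1..4}" for i j k
    using assms(3) that by (intro bracket_nonzero) (auto simp: general_position_def)
  have swap: "bracket (x 4) (x 2) (x 3) = bracket (x 2) (x 3) (x 4)"
    "bracket (x 1) (x 4) (x 3) = - bracket (x 1) (x 3) (x 4)"
    by (simp_all add: cross3_simps)
  interpret quadrangle x
    by unfold_locales (simp_all only: swap neg_equal_0_iff_equal, (rule nc; simp)+)
  let ?R = "{s. s \<noteq> 0 \<and> s \<noteq> 1 \<and> tangency_root x l s}"
  note R = tangency_roots[OF assms(2)]
  have image: "solution_conics x l = (\<lambda>s. conic_class (conic_matrix x s)) ` ?R"
    unfolding solution_conics_eq by blast
  have "card (solution_conics x l) \<le> 2"
    using card_image_le[OF R(1)] R(2) unfolding image by (rule order_trans)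
  with R(1) show ?thesis
    by (simp add: image invertible_xi_matrix) (simp flip: image add: solution_conics_eq)
qed

end
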